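(* Let $H$ be a $k$-regular bipartite graph of order $m$ with a fixed bipartition $(X,Y)$, and let $H^\tau$ be an orientation of $H$ with skew energy $m\sqrt{k}$. Let $G^\sigma$ be an oriented $l$-regular graph of order $n$ with skew energy $n\sqrt{l}$. Then $(H^\tau\ast G^\sigma)^o$ is an oriented $(k+l+kl)$-regular graph and has the maximum skew energy $\mathcal{E}_S((H^\tau\ast G^\sigma)^o)=mn\sqrt{k+l+kl}$.
   Context: For an oriented graph $D$ on vertices $w_1,\dots,w_N$, its skew-adjacency matrix $S(D)=[s_{ab}]$ has $s_{ab}=1$, $s_{ba}=-1$ if $\langle w_a,w_b\rangle$ is an arc of $D$, and $s_{ab}=s_{ba}=0$ otherwise. The skew energy $\mathcal{E}_S(D)$ is the sum of the absolute values of the eigenvalues of $S(D)$; for an oriented graph of order $N$ and maximum degree $\Delta$ one always has $\mathcal{E}_S\le N\sqrt{\Delta}$, and $N\sqrt{\Delta}$ is called the maximum skew energy. The strong product $H\ast G$ has vertex set $V(H)\times V(G)$, two distinct pairs $(u_1,v_1),(u_2,v_2)$ being adjacent iff $u_1$ is equal or adjacent to $u_2$ and $v_1$ is equal or adjacent to $v_2$. The orientation $(H^\tau\ast G^\sigma)^o$ orients each edge as follows. (i) If $u_1=u_2\in X$: arc from $(u_1,v_1)$ to $(u_2,v_2)$ if $\langle v_1,v_2\rangle$ is an arc of $G^\sigma$, otherwise the reverse arc. (ii) If $u_1=u_2\in Y$: arc from $(u_1,v_1)$ to $(u_2,v_2)$ if $\langle v_2,v_1\rangle$ is an arc of $G^\sigma$,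 otherwise the reverse arc. (iii) If $v_1=v_2$: arc from $(u_1,v_1)$ to $(u_2,v_2)$ if $\langle u_1,u_2\rangle$ is an arc of $H^\tau$, otherwise the reverse arc. (iv) If $u_1u_2\in E(H)$ and $v_1v_2\in E(G)$, with $u_1\in X$: arc from $(u_1,v_1)$ to $(u_2,v_2)$ if either ($\langle u_1,u_2\rangle$ is an arc of $H^\tau$ and $\langle v_1,v_2\rangle$ is an arc of $G^\sigma$) or ($\langle u_2,u_1\rangle$ is an arc of $H^\tau$ and $\langle v_2,v_1\rangle$ is an arc of $G^\sigma$); otherwise the reverse arc. *)

theory Defs
  imports
    "Graph_Theory.Graph_Theory"
    "Jordan_Normal_Form.Spectral_Radius"
begin

text \<open>
  Finite simple undirected graphs are the symmetric loop-free digraphs of the locale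
  \<^locale>\<open>pair_graph\<close>: an edge is a pair of opposite arcs, so the degree of a vertex is its
  out-degree. Vertex sets are allowed to be empty.
\<close>

definition regular_graph :: "nat \<Rightarrow> 'a pair_pre_digraph \<Rightarrow> bool" where
  "regular_graph d G \<longleftrightarrow> pair_graph G \<and> (\<forall>v\<in>pverts G. out_degree (with_proj G) v = d)"

definition max_degree :: "'a pair_pre_digraph \<Rightarrow> nat" where
  "max_degree G = Max (out_degree (with_proj G) ` pverts G)"

definition bipartition :: "'a pair_pre_digraph \<Rightarrow> 'a set \<Rightarrow> 'a set \<Rightarrow> bool" where
  "bipartition G X Y \<longleftrightarrow> pverts G = X \<union> Y \<and> X \<inter> Y = {} \<and>
     (\<forall>(u, v)\<in>parcs G. u \<in> X \<and> v \<in> Y \<or> u \<in> Y \<and> v \<in> X)"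

definition oriented_graph :: "'a pair_pre_digraph \<Rightarrow> bool" where
  "oriented_graph D \<longleftrightarrow> pair_digraph D \<and> (\<forall>(u, v)\<in>parcs D. (v, u) \<notin> parcs D)"

abbreviation underlying :: "'a pair_pre_digraph \<Rightarrow> 'a pair_pre_digraph" where
  "underlying D \<equiv> mk_symmetric (with_proj D)"

definition orientation_of :: "'a pair_pre_digraph \<Rightarrow> 'a pair_pre_digraph \<Rightarrow> bool" where
  "orientation_of D G \<longleftrightarrow> oriented_graph D \<and> underlying D = G"

definition skew_adjacency_mat :: "'a pair_pre_digraph \<Rightarrow> 'a list \<Rightarrow> complex mat" where
  "skew_adjacency_mat D ws = mat (length ws) (length ws) (\<lambda>(a, b).
     if (ws ! a, ws ! b) \<in> parcs D then 1
     else if (ws ! b, ws ! a) \<in> parcs D then - 1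
     else 0)"

definition vertex_enum :: "'a pair_pre_digraph \<Rightarrow> 'a list" where
  "vertex_enum D = (SOME ws. distinct ws \<and> set ws = pverts D)"

text \<open>
  Eigenvalues are counted with algebraic multiplicity. The choice of the vertex enumeration is
  immaterial, since another one gives a permutation-similar matrix.
\<close>

definition skew_energy :: "'a pair_pre_digraph \<Rightarrow> real" where
  "skew_energy D = (let S = skew_adjacency_mat D (vertex_enum D) in
     \<Sum>\<mu>\<in>spectrum S. real (Polynomial.order \<mu> (char_poly S)) * cmod \<mu>)"

definition max_skew_energy :: "'a pair_pre_digraph \<Rightarrow> real" where
  "max_skew_energy D = real (card (pverts D)) * sqrt (real (max_degree (underlying D)))"

definition strong_product ::
  "'a pair_pre_digraph \<Rightarrow> 'b pair_pre_digraph \<Rightarrow> ('a \<times> 'b) pair_pre_digraph" where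
  "strong_product H G = \<lparr>
     pverts = pverts H \<times> pverts G,
     parcs = {((u1, v1), (u2, v2)) | u1 v1 u2 v2.
       (u1, v1) \<in> pverts H \<times> pverts G \<and> (u2, v2) \<in> pverts H \<times> pverts G \<and>
       (u1, v1) \<noteq> (u2, v2) \<and>
       (u1 = u2 \<or> (u1, u2) \<in> parcs H) \<and> (v1 = v2 \<or> (v1, v2) \<in> parcs G)}\<rparr>"

text \<open>
  The arcs of the orientation of the strong product, for \<open>D\<close> an orientation of a bipartite graph
  with parts \<open>X\<close>, \<open>Y\<close> and \<open>E\<close> an oriented graph. For each kind of edge there is one rule for the
  arc from \<open>(u1, v1)\<close> to \<open>(u2, v2)\<close>, and one (\<open>_rev\<close>) for the reverse arc.
\<close>

inductive_set strong_arcs ::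
  "'a set \<Rightarrow> 'a set \<Rightarrow> 'a pair_pre_digraph \<Rightarrow> 'b pair_pre_digraph \<Rightarrow> ('a \<times> 'b) rel"
  for X Y :: "'a set" and D :: "'a pair_pre_digraph" and E :: "'b pair_pre_digraph"
where
  in_X: "\<lbrakk>u \<in> X; (v1, v2) \<in> parcs (underlying E); (v1, v2) \<in> parcs E\<rbrakk>
    \<Longrightarrow> ((u, v1), (u, v2)) \<in> strong_arcs X Y D E"
| in_X_rev: "\<lbrakk>u \<in> X; (v1, v2) \<in> parcs (underlying E); (v1, v2) \<notin> parcs E\<rbrakk>
    \<Longrightarrow> ((u, v2), (u, v1)) \<in> strong_arcs X Y D E"
| in_Y: "\<lbrakk>u \<in> Y; (v1, v2) \<in> parcs (underlying E); (v2, v1) \<in> parcs E\<rbrakk>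
    \<Longrightarrow> ((u, v1), (u, v2)) \<in> strong_arcs X Y D E"
| in_Y_rev: "\<lbrakk>u \<in> Y; (v1, v2) \<in> parcs (underlying E); (v2, v1) \<notin> parcs E\<rbrakk>
    \<Longrightarrow> ((u, v2), (u, v1)) \<in> strong_arcs X Y D E"
| same_v: "\<lbrakk>v \<in> pverts E; (u1, u2) \<in> parcs (underlying D); (u1, u2) \<in> parcs D\<rbrakk>
    \<Longrightarrow> ((u1, v), (u2, v)) \<in> strong_arcs X Y D E"
| same_v_rev: "\<lbrakk>v \<in> pverts E; (u1, u2) \<in> parcs (underlying D); (u1, u2) \<notin> parcs D\<rbrakk>
    \<Longrightarrow> ((u2, v), (u1, v)) \<in> strong_arcs X Y D E"
| both: "\<lbrakk>(u1, u2) \<in> parcs (underlying D); (v1, v2) \<in> parcs (underlying E); u1 \<in> X;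
     (u1, u2) \<in> parcs D \<and> (v1, v2) \<in> parcs E \<or> (u2, u1) \<in> parcs D \<and> (v2, v1) \<in> parcs E\<rbrakk>
    \<Longrightarrow> ((u1, v1), (u2, v2)) \<in> strong_arcs X Y D E"
| both_rev: "\<lbrakk>(u1, u2) \<in> parcs (underlying D); (v1, v2) \<in> parcs (underlying E); u1 \<in> X;
     \<not> ((u1, u2) \<in> parcs D \<and> (v1, v2) \<in> parcs E \<or> (u2, u1) \<in> parcs D \<and> (v2, v1) \<in> parcs E)\<rbrakk>
    \<Longrightarrow> ((u2, v2), (u1, v1)) \<in> strong_arcs X Y D E"

definition oriented_strong_product ::
  "'a set \<Rightarrow> 'a set \<Rightarrow> 'a pair_pre_digraph \<Rightarrow> 'b pair_pre_digraph \<Rightarrow> ('a \<times> 'b) pair_pre_digraph"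
where
  "oriented_strong_product X Y D E =
     \<lparr>pverts = pverts D \<times> pverts E, parcs = strong_arcs X Y D E\<rparr>"

end

theory Submission
  imports Defs
begin

text \<open>
  A skew-adjacency matrix \<open>S\<close> of a \<open>d\<close>-regular oriented graph attains the maximum skew energy
  iff \<open>S\<^sup>2 = - d I\<close>: its eigenvalues are imaginary with \<open>\<Sum>|\<mu>|\<^sup>2 = N d\<close>, so by Cauchy-Schwarz
  \<open>\<Sum>|\<mu>| = N \<surd>d\<close> forces \<open>\<mu>\<^sup>2 = - d\<close> for every eigenvalue. For the product,
  \<open>S = P (I + S\<^sub>H) \<otimes> S\<^sub>G + S\<^sub>H \<otimes> I\<close> with \<open>P\<close> the diagonal matrix of signs of the bipartition. As
  \<open>P\<close> anticommutes with \<open>S\<^sub>H\<close>, the mixed terms of \<open>S\<^sup>2\<close> cancel and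
  \<open>S\<^sup>2 = (I - S\<^sub>H\<^sup>2) \<otimes> S\<^sub>G\<^sup>2 + S\<^sub>H\<^sup>2 \<otimes> I = - (k + l + k l) I\<close>.
\<close>

section \<open>Traces of powers through triangularisation\<close>

definition mat_trace :: "'a :: comm_monoid_add mat \<Rightarrow> 'a" where
  "mat_trace A = (\<Sum>i<dim_row A. A $$ (i, i))"

lemma mat_trace_mult_comm:
  fixes A B :: "'a :: comm_semiring_0 mat"
  assumes "A \<in> carrier_mat n m" "B \<in> carrier_mat m n"
  shows "mat_trace (A * B) = mat_trace (B * A)"
proof -
  have "mat_trace (A * B) = (\<Sum>i<n. \<Sum>j<m. A $$ (i, j) * B $$ (j, i))"
    using assms by (auto simp: mat_trace_def scalar_prod_def atLeast0LessThan)
  also have "\<dots> = (\<Sum>j<m. \<Sum>i<n. B $$ (j, i) * A $$ (i, j))"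
    by (subst sum.swap) (simp add: mult.commute)
  also have "\<dots> = mat_trace (B * A)"
    using assms by (auto simp: mat_trace_def scalar_prod_def atLeast0LessThan)
  finally show ?thesis .
qed

lemma mat_trace_similar:
  fixes A B :: "'a :: comm_ring_1 mat"
  assumes "similar_mat_wit A B P Q"
  shows "mat_trace A = mat_trace B"
proof -
  obtain n where QP: "Q * P = 1\<^sub>m n" and A: "A = P * B * Q"
    and B: "B \<in> carrier_mat n n" and P: "P \<in> carrier_mat n n" and Q: "Q \<in> carrier_mat n n"
    using similar_mat_witD[OF refl assms] by blast
  have "mat_trace A = mat_trace (P * (B * Q))"
    unfolding A assoc_mult_mat[OF P B Q] ..
  also have "\<dots> = mat_trace (B * Q * P)"
    using B P Q by (intro mat_trace_mult_comm) auto
  also have "B * Q * P = B"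
    using B by (simp add: assoc_mult_mat[OF B Q P] QP)
  finally show ?thesis .
qed

text \<open>A term \<open>B $$ (i, l) * B $$ (l, j)\<close> can be nonzero only for i \<le> l \<le>
  j. No such l exists below the diagonal, and on the diagonal only l = i survives.\<close>

lemma upper_triangular_square:
  fixes B :: "'a :: comm_ring_1 mat"
  assumes B: "B \<in> carrier_mat n n" and ut: "upper_triangular B"
  shows "upper_triangular (B * B)" "i < n \<Longrightarrow> (B * B) $$ (i, i) = (B $$ (i, i))\<^sup>2"
proof -
  have entry: "(B * B) $$ (i, j) = (\<Sum>l<n. B $$ (i, l) * B $$ (l, j))" if "i < n" "j < n" for i j
    using B that by (auto simp: scalar_prod_def atLeast0LessThan)
  have zero: "B $$ (i, j) = 0" if "j < i" "i < n" for i j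
    using upper_triangularD[OF ut] that B by auto
  show "upper_triangular (B * B)"
  proof
    fix i j assume "j < i" "i < dim_row (B * B)"
    then have ij: "j < i" "i < n" using B by auto
    have "B $$ (i, l) * B $$ (l, j) = 0" if "l < n" for l
      using zero[of l i] zero[of j l] ij that by (cases "l < i") auto
    then show "(B * B) $$ (i, j) = 0"
      using ij by (subst entry) auto
  qed
  assume i: "i < n"
  have "B $$ (i, l) * B $$ (l, i) = (if l = i then (B $$ (i, i))\<^sup>2 else 0)" if "l < n" for l
    using zero[of l i] zero[of i l] i that by (cases l i rule: linorder_cases) (auto simp: power2_eq_square)
  then have "(\<Sum>l<n. B $$ (i, l) * B $$ (l, i)) = (\<Sum>l<n. if l = i then (B $$ (i, i))\<^sup>2 else 0)"
    by (intro sum.cong) auto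
  then show "(B * B) $$ (i, i) = (B $$ (i, i))\<^sup>2"
    using i by (simp add: entry)
qed

text \<open>The Schur form of \<open>A\<close> is upper triangular with diagonal \<open>es\<close>.
  Squaring it once and then again keeps it similar to the corresponding power of \<open>A\<close>
  and squares its diagonal entries each time.\<close>

lemma mat_trace_powers:
  fixes A :: "complex mat"
  assumes A: "A \<in> carrier_mat n n" and cp: "char_poly A = (\<Prod>e\<leftarrow>es. [:- e, 1:])"
  shows "mat_trace (A * A) = (\<Sum>e\<leftarrow>es. e\<^sup>2)" "mat_trace (A * A * (A * A)) = (\<Sum>e\<leftarrow>es. e ^ 4)"
proof -
  obtain B P Q where s: "schur_decomposition A es = (B, P, Q)"
    by (metis prod_cases3)
  from schur_decomposition[OF A cp s]
  have w: "similar_mat_wit A B P Q" and ut: "upper_triangular B" and es: "es = diag_mat B"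
    by auto
  have B: "B \<in> carrier_mat n n"
    using similar_mat_witD2[OF A w] by auto
  have w2: "similar_mat_wit (A * A) (B * B) P Q"
    using similar_mat_wit_pow[OF w, of 2] A B by (simp add: numeral_2_eq_2)
  have w4: "similar_mat_wit (A * A * (A * A)) (B * B * (B * B)) P Q"
    using similar_mat_wit_pow[OF w2, of 2] A B by (simp add: numeral_2_eq_2)
  have BB: "B * B \<in> carrier_mat n n" using B by auto
  note ut2 = upper_triangular_square[OF B ut]
  note ut4 = upper_triangular_square[OF BB ut2(1)]
  have sl: "(\<Sum>e\<leftarrow>es. f e) = (\<Sum>i<n. f (B $$ (i, i)))" for f :: "complex \<Rightarrow> complex"
    using B by (simp add: es diag_mat_def interv_sum_list_conv_sum_set_nat atLeast0LessThan o_def)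
  show "mat_trace (A * A) = (\<Sum>e\<leftarrow>es. e\<^sup>2)"
    unfolding mat_trace_similar[OF w2] sl using B ut2(2)
    by (simp add: mat_trace_def del: index_mult_mat(1))
  show "mat_trace (A * A * (A * A)) = (\<Sum>e\<leftarrow>es. e ^ 4)"
    unfolding mat_trace_similar[OF w4] sl using B ut2(2) ut4(2)
    by (simp add: mat_trace_def del: index_mult_mat(1))
qed

section \<open>Energy as a sum over the list of eigenvalues\<close>

text \<open>The sum inside \<open>skew_energy\<close>, taken for any complex matrix, so that the
  spectral argument can be carried out apart from graphs.\<close>

definition mat_energy :: "complex mat \<Rightarrow> real" where
  "mat_energy A = (\<Sum>\<mu>\<in>spectrum A. real (Polynomial.order \<mu> (char_poly A)) * cmod \<mu>)"

lemma order_prod_linear_factors: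
  fixes x :: "'a :: field"
  shows "Polynomial.order x (\<Prod>e\<leftarrow>es. [:- e, 1:]) = count_list es x"
proof (induction es)
  case (Cons e es)
  have "(\<Prod>e\<leftarrow>e # es. [:- e, 1:]) \<noteq> 0"
    by (subst prod_list_zero_iff) auto
  then have "Polynomial.order x (\<Prod>e\<leftarrow>e # es. [:- e, 1:]) =
      Polynomial.order x [:- e, 1:] + Polynomial.order x (\<Prod>e\<leftarrow>es. [:- e, 1:])"
    unfolding list.map prod_list.Cons by (rule order_mult)
  then show ?case
    by (simp add: Cons order_linear')
qed simp

lemma sum_count_list_mult:
  fixes f :: "'a \<Rightarrow> real"
  assumes "finite S" "set xs \<subseteq> S"
  shows "(\<Sum>x\<in>S. real (count_list xs x) * f x) = (\<Sum>x\<leftarrow>xs. f x)"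
  using assms(2)
proof (induction xs)
  case (Cons y xs)
  have "(\<Sum>x\<in>S. real (count_list (y # xs) x) * f x) =
      (\<Sum>x\<in>S. real (count_list xs x) * f x + (if x = y then f y else 0))"
    by (intro sum.cong) (auto simp: algebra_simps)
  with Cons assms(1) show ?case
    by (simp add: sum.distrib)
qed simp

text \<open>The order of a root equals its number of occurrences in \<open>es\<close>, so weighting
  by algebraic multiplicity amounts to summing over the list.\<close>

lemma mat_energy_eq_sum_list:
  assumes A: "A \<in> carrier_mat n n" and cp: "char_poly A = (\<Prod>e\<leftarrow>es. [:- e, 1:])"
  shows "spectrum A = set es" "mat_energy A = (\<Sum>e\<leftarrow>es. cmod e)"
proof -
  show spec: "spectrum A = set es"
    unfolding spectrum_root_char_poly[OF A] cp
    by (auto simp: poly_prod_list prod_list_zero_iff)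
  show "mat_energy A = (\<Sum>e\<leftarrow>es. cmod e)"
    unfolding mat_energy_def spec cp order_prod_linear_factors
    by (simp add: sum_count_list_mult)
qed

section \<open>Extremal energy of skew-Hermitian matrices\<close>

text \<open>For an eigenvector \<open>v\<close>, the form \<open>q\<close> = v^H A v equals \<mu>
  times the squared norm \<open>N\<close> of \<open>v\<close>, while skewness gives
  \<open>cnj q = - q\<close>. Hence Re \<mu> times \<open>N\<close> vanishes, and \<open>N\<close>
  is nonzero.\<close>

lemma skew_hermitian_eigenvalue:
  assumes A: "A \<in> carrier_mat n n"
    and skew: "\<And>i j. i < n \<Longrightarrow> j < n \<Longrightarrow> cnj (A $$ (i, j)) = - A $$ (j, i)"
    and ev: "eigenvalue A \<mu>"
  shows "Re \<mu> = 0"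
proof -
  obtain v where v: "v \<in> carrier_vec n" "v \<noteq> 0\<^sub>v n" "A *\<^sub>v v = \<mu> \<cdot>\<^sub>v v"
    using ev A by (auto simp: eigenvalue_def eigenvector_def)
  have row: "(\<Sum>j<n. A $$ (i, j) * v $ j) = \<mu> * v $ i" if "i < n" for i
  proof -
    have "(A *\<^sub>v v) $ i = (\<Sum>j<n. A $$ (i, j) * v $ j)"
      using A v(1) that by (auto simp: scalar_prod_def atLeast0LessThan)
    then show ?thesis using v that by simp
  qed
  define q where "q = (\<Sum>i<n. \<Sum>j<n. cnj (v $ i) * A $$ (i, j) * v $ j)"
  define N where "N = (\<Sum>i<n. (cmod (v $ i))\<^sup>2)"
  have "q = (\<Sum>i<n. cnj (v $ i) * (\<Sum>j<n. A $$ (i, j) * v $ j))"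
    by (simp add: q_def sum_distrib_left mult.assoc)
  also have "\<dots> = (\<Sum>i<n. \<mu> * complex_of_real ((cmod (v $ i))\<^sup>2))"
    by (intro sum.cong) (simp_all add: row complex_norm_square del: of_real_power)
  finally have q: "q = \<mu> * complex_of_real N"
    by (simp add: N_def sum_distrib_left)
  have "cnj q = (\<Sum>i<n. \<Sum>j<n. - (cnj (v $ j) * A $$ (j, i) * v $ i))"
    unfolding q_def cnj_sum by (intro sum.cong) (auto simp: skew)
  also have "\<dots> = - q"
    unfolding q_def by (subst sum.swap) (simp add: sum_negf)
  finally have "cnj q = - q" .
  then have "Re q = 0"
    by (simp add: complex_eq_iff)
  then have "Re \<mu> * N = 0"
    by (simp add: q)
  moreover have "N \<noteq> 0"
  proof
    assume "N = 0"
    then have "\<forall>i<n. v $ i = 0"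
      by (auto simp: N_def sum_nonneg_eq_0_iff)
    then show False using v by (auto intro: eq_vecI)
  qed
  ultimately show ?thesis by simp
qed

text \<open>
  Once \<open>\<mu>\<^sup>2 = - d\<close> for all eigenvalues, the Hermitian matrix \<open>A\<^sup>2 + d I\<close> has vanishing Frobenius
  norm, as the trace of its square is \<open>\<Sum>(\<mu>\<^sup>2 + d)\<^sup>2\<close>; so no diagonalisation is needed.
\<close>

lemma skew_hermitian_square_of_energy:
  fixes d :: real
  assumes A: "A \<in> carrier_mat n n" and d: "d \<ge> 0"
    and skew: "\<And>i j. i < n \<Longrightarrow> j < n \<Longrightarrow> cnj (A $$ (i, j)) = - A $$ (j, i)"
    and diag: "\<And>i. i < n \<Longrightarrow> (A * A) $$ (i, i) = - of_real d"
    and energy: "mat_energy A = real n * sqrt d"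
  shows "A * A = (- of_real d) \<cdot>\<^sub>m 1\<^sub>m n"
proof -
  obtain es where cp: "char_poly A = (\<Prod>e\<leftarrow>es. [:- e, 1:])" and len: "length es = n"
    using char_poly_factorized[OF A] by blast
  \<comment> \<open>Eigenvalues are imaginary, so each square is minus the squared modulus; the
    trace of \<open>A * A\<close> thereby fixes the sum of the squared moduli.\<close>
  have im: "e\<^sup>2 = - of_real ((cmod e)\<^sup>2)" if "e \<in> set es" for e
  proof -
    have "Re e = 0"
      using skew_hermitian_eigenvalue[OF A skew] mat_energy_eq_sum_list(1)[OF A cp] that
      by (auto simp: spectrum_def)
    then show ?thesis
      by (simp add: complex_eq_iff cmod_def power2_eq_square)
  qed
  have tr2: "(\<Sum>e\<leftarrow>es. e\<^sup>2) = - of_nat n * of_real d"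
    using A by (simp add: mat_trace_powers(1)[OF A cp, symmetric] mat_trace_def diag
        del: index_mult_mat(1))
  have "(\<Sum>e\<leftarrow>es. e\<^sup>2) = (\<Sum>e\<leftarrow>es. - of_real ((cmod e)\<^sup>2))"
    by (rule arg_cong[of _ _ sum_list], rule map_cong) (auto simp: im)
  also have "\<dots> = - of_real (\<Sum>e\<leftarrow>es. (cmod e)\<^sup>2)"
    by (induction es) auto
  finally have "complex_of_real (\<Sum>e\<leftarrow>es. (cmod e)\<^sup>2) = of_real (real n * d)"
    using tr2 by simp
  then have sq: "(\<Sum>e\<leftarrow>es. (cmod e)\<^sup>2) = real n * d"
    using of_real_eq_iff by blast
  \<comment> \<open>The equality case of Cauchy-Schwarz, made explicit: the expansion evaluates to
    nd - 2nd + nd, so every modulus is \<open>sqrt d\<close>.\<close>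
  have "(\<Sum>e\<leftarrow>es. (cmod e - sqrt d)\<^sup>2) =
      (\<Sum>e\<leftarrow>es. (cmod e)\<^sup>2) - 2 * sqrt d * (\<Sum>e\<leftarrow>es. cmod e) + real (length es) * d"
    using d by (induction es) (auto simp: power2_diff algebra_simps)
  also have "\<dots> = 0"
    using sq len energy d by (simp add: mat_energy_eq_sum_list(2)[OF A cp])
  finally have "(\<Sum>e\<leftarrow>es. (cmod e - sqrt d)\<^sup>2) = 0" .
  then have "\<forall>e\<in>set es. (cmod e - sqrt d)\<^sup>2 = 0"
    by (subst (asm) sum_list_nonneg_eq_0_iff) auto
  then have ev: "e\<^sup>2 = - of_real d" if "e \<in> set es" for e
    using that im d by auto
  have "(\<Sum>e\<leftarrow>es. e ^ 4) = (\<Sum>e\<leftarrow>es. (of_real d)\<^sup>2)"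
  proof (rule arg_cong[of _ _ sum_list], rule map_cong)
    fix e assume "e \<in> set es"
    have "e ^ 4 = (e\<^sup>2)\<^sup>2" by simp
    then show "e ^ 4 = (of_real d)\<^sup>2" using ev[OF \<open>e \<in> set es\<close>] by simp
  qed simp
  also have "\<dots> = of_real (real n * d\<^sup>2)"
    by (simp add: len sum_list_triv)
  finally have tr4: "mat_trace (A * A * (A * A)) = of_real (real n * d\<^sup>2)"
    using mat_trace_powers(2)[OF A cp] by simp
  define C where "C = A * A"
  have C: "C \<in> carrier_mat n n" using A by (auto simp: C_def)
  have herm: "cnj (C $$ (i, j)) = C $$ (j, i)" if "i < n" "j < n" for i j
    using A that by (auto simp: C_def scalar_prod_def skew mult.commute intro!: sum.cong)
  \<comment> \<open>Since \<open>C\<close> is Hermitian, the trace of its square is its squared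
    Frobenius norm, which \<open>tr4\<close> evaluates.\<close>
  have "mat_trace (C * C) = (\<Sum>i<n. \<Sum>j<n. C $$ (i, j) * cnj (C $$ (i, j)))"
    using C by (auto simp: mat_trace_def scalar_prod_def herm atLeast0LessThan intro!: sum.cong)
  also have "\<dots> = of_real (\<Sum>i<n. \<Sum>j<n. (cmod (C $$ (i, j)))\<^sup>2)"
    by (simp add: complex_norm_square del: of_real_power)
  finally have "complex_of_real (\<Sum>i<n. \<Sum>j<n. (cmod (C $$ (i, j)))\<^sup>2) = of_real (real n * d\<^sup>2)"
    using tr4 by (simp add: C_def)
  then have frob: "(\<Sum>i<n. \<Sum>j<n. (cmod (C $$ (i, j)))\<^sup>2) = real n * d\<^sup>2"
    using of_real_eq_iff by blast
  have Cii: "C $$ (i, i) = - of_real d" if "i < n" for i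
    using diag that by (simp add: C_def)
  \<comment> \<open>The n diagonal entries of modulus \<open>d\<close> already exhaust the Frobenius
    norm, leaving zero for the off-diagonal entries.\<close>
  have "(\<Sum>i<n. \<Sum>j\<in>{..<n} - {i}. (cmod (C $$ (i, j)))\<^sup>2) =
      (\<Sum>i<n. (\<Sum>j<n. (cmod (C $$ (i, j)))\<^sup>2) - d\<^sup>2)"
  proof (rule sum.cong)
    fix i assume "i \<in> {..<n}"
    then show "(\<Sum>j\<in>{..<n} - {i}. (cmod (C $$ (i, j)))\<^sup>2) = (\<Sum>j<n. (cmod (C $$ (i, j)))\<^sup>2) - d\<^sup>2"
      by (subst sum.remove[of "{..<n}" i]) (auto simp: Cii)
  qed simp
  also have "\<dots> = 0"
    using frob by (simp add: sum_subtractf)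
  finally have "\<forall>i<n. \<forall>j\<in>{..<n} - {i}. C $$ (i, j) = 0"
    by (simp add: sum_nonneg_eq_0_iff sum_nonneg)
  then have "C = (- of_real d) \<cdot>\<^sub>m 1\<^sub>m n"
    using C by (intro eq_matI) (auto simp: Cii)
  then show ?thesis by (simp add: C_def)
qed

text \<open>Applying \<open>A\<close> twice to an eigenvector for \<open>e\<close> gives
  \<open>e * e = - of_real d\<close>, so all n eigenvalues in the list have modulus
  \<open>sqrt d\<close>.\<close>

lemma mat_energy_of_square:
  fixes d :: real
  assumes A: "A \<in> carrier_mat n n" and d: "d \<ge> 0"
    and sq: "A * A = (- of_real d) \<cdot>\<^sub>m 1\<^sub>m n"
  shows "mat_energy A = real n * sqrt d"
proof -
  obtain es where cp: "char_poly A = (\<Prod>e\<leftarrow>es. [:- e, 1:])" and len: "length es = n"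
    using char_poly_factorized[OF A] by blast
  have "cmod e = sqrt d" if "e \<in> set es" for e
  proof -
    have "eigenvalue A e"
      using mat_energy_eq_sum_list(1)[OF A cp] that by (auto simp: spectrum_def)
    then obtain v where v: "v \<in> carrier_vec n" "v \<noteq> 0\<^sub>v n" "A *\<^sub>v v = e \<cdot>\<^sub>v v"
      using A by (auto simp: eigenvalue_def eigenvector_def)
    have "(A * A) *\<^sub>v v = e \<cdot>\<^sub>v (e \<cdot>\<^sub>v v)"
      using A v by (simp add: assoc_mult_mat_vec[OF A A] mult_mat_vec[OF A])
    moreover have "(- of_real d \<cdot>\<^sub>m 1\<^sub>m n) *\<^sub>v v = - of_real d \<cdot>\<^sub>v v"
      using v(1) by (intro eq_vecI) auto
    ultimately have *: "- of_real d \<cdot>\<^sub>v v = e \<cdot>\<^sub>v (e \<cdot>\<^sub>v v)"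
      by (simp add: sq)
    obtain i where i: "i < n" "v $ i \<noteq> 0"
      using v(1,2) by (auto simp: vec_eq_iff)
    have "- of_real d * v $ i = e * (e * v $ i)"
      using arg_cong[OF *, of "\<lambda>v. v $ i"] i v by simp
    then have "(e * e) * v $ i = (- of_real d) * v $ i"
      by (simp only: mult.assoc)
    then have "e * e = - of_real d"
      using mult_right_cancel[OF i(2)] by blast
    then have "cmod e * cmod e = d"
      using d by (simp flip: norm_mult)
    then show ?thesis
      by (simp add: real_sqrt_unique power2_eq_square)
  qed
  then have "(\<Sum>e\<leftarrow>es. cmod e) = (\<Sum>e\<leftarrow>es. sqrt d)"
    by (intro arg_cong[of _ _ sum_list] map_cong) auto
  then show ?thesis
    by (simp add: mat_energy_eq_sum_list(2)[OF A cp] len sum_list_triv)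
qed

section \<open>Energy criterion in terms of vertices\<close>

text \<open>The skew-adjacency matrix indexed by vertices instead of positions in an enumeration.
  Matrix products become sums over the vertex set, which factor directly over a Cartesian
  product.\<close>

definition skew_entry :: "'a pair_pre_digraph \<Rightarrow> 'a \<Rightarrow> 'a \<Rightarrow> complex" where
  "skew_entry D u v = (if (u, v) \<in> parcs D then 1 else if (v, u) \<in> parcs D then - 1 else 0)"

lemma in_parcs_underlying_iff:
  "(u, v) \<in> parcs (underlying D) \<longleftrightarrow> (u, v) \<in> parcs D \<or> (v, u) \<in> parcs D"
proof -
  have "(u, v) \<in> parcs (underlying D) \<longleftrightarrow> (\<exists>e\<in>parcs D. e = (u, v) \<or> e = (v, u))"
    by (auto simp: parcs_mk_symmetric prod_eq_iff)
  then show ?thesis by blast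
qed

lemma out_degree_with_proj: "out_degree (with_proj G) u = card {w. (u, w) \<in> parcs G}"
proof -
  have "out_arcs (with_proj G) u = Pair u ` {w. (u, w) \<in> parcs G}"
    by (auto simp: out_arcs_def)
  then show ?thesis
    by (simp add: out_degree_def card_image inj_on_def)
qed

lemma skew_entry_swap:
  assumes "oriented_graph D"
  shows "skew_entry D v u = - skew_entry D u v"
  using assms by (auto simp: oriented_graph_def skew_entry_def)

lemma oriented_graph_finite_verts: "oriented_graph D \<Longrightarrow> finite (pverts D)"
  by (simp add: oriented_graph_def pair_digraph_def pair_fin_digraph.pair_finite_verts)

lemma oriented_graph_parcs:
  assumes "oriented_graph D" "(u, v) \<in> parcs D"
  shows "u \<in> pverts D" "v \<in> pverts D" "u \<noteq> v" "(v, u) \<notin> parcs D"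
proof -
  interpret pair_digraph D using assms by (simp add: oriented_graph_def)
  show "u \<in> pverts D" "v \<in> pverts D" "u \<noteq> v" "(v, u) \<notin> parcs D"
    using assms wellformed' pair_no_loops by (auto simp: oriented_graph_def)
qed

text \<open>Exactly one direction of each edge is an arc, so every neighbour of \<open>u\<close>
  contributes 1 times -1, and all other vertices contribute 0.\<close>

lemma sum_skew_entry_diag:
  assumes D: "oriented_graph D"
  shows "(\<Sum>w\<in>pverts D. skew_entry D u w * skew_entry D w u) =
    - of_nat (out_degree (with_proj (underlying D)) u)"
proof -
  let ?N = "{w. (u, w) \<in> parcs (underlying D)}"
  have N: "?N \<subseteq> pverts D"
    using oriented_graph_parcs[OF D] by (auto simp: in_parcs_underlying_iff)
  have "(\<Sum>w\<in>pverts D. skew_entry D u w * skew_entry D w u) =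
      (\<Sum>w\<in>pverts D. if w \<in> ?N then - 1 else 0)"
    using oriented_graph_parcs(4)[OF D]
    by (intro sum.cong) (auto simp: skew_entry_def in_parcs_underlying_iff)
  also have "\<dots> = (\<Sum>w\<in>?N. - 1)"
    by (rule sum.mono_neutral_cong_right) (use N oriented_graph_finite_verts[OF D] in auto)
  also have "\<dots> = - of_nat (card ?N)"
    by simp
  finally show ?thesis
    by (simp add: out_degree_with_proj)
qed

lemma vertex_enum:
  assumes "finite (pverts D)"
  shows "distinct (vertex_enum D)" "set (vertex_enum D) = pverts D"
proof -
  have "\<exists>ws. distinct ws \<and> set ws = pverts D"
    using finite_distinct_list[OF assms] by blast
  from someI_ex[OF this] show "distinct (vertex_enum D)" "set (vertex_enum D) = pverts D"
    by (auto simp: vertex_enum_def)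
qed

text \<open>The right-hand side is S^2 = - d I without reference to an enumeration. The criterion is
  read forwards for the two factors and backwards for their product.\<close>

lemma skew_energy_eq_max_iff:
  assumes D: "oriented_graph D"
    and deg: "\<And>u. u \<in> pverts D \<Longrightarrow> out_degree (with_proj (underlying D)) u = d"
  shows "skew_energy D = real (card (pverts D)) * sqrt (real d) \<longleftrightarrow>
    (\<forall>u\<in>pverts D. \<forall>v\<in>pverts D. (\<Sum>w\<in>pverts D. skew_entry D u w * skew_entry D w v) =
      (if u = v then - of_nat d else 0))"
    (is "_ \<longleftrightarrow> ?orth")
proof -
  define ws where "ws = vertex_enum D"
  define n where "n = card (pverts D)"
  define A where "A = skew_adjacency_mat D ws"
  note ws = vertex_enum[OF oriented_graph_finite_verts[OF D], folded ws_def]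
  have len: "length ws = n"
    using ws distinct_card by (fastforce simp: n_def)
  have A: "A \<in> carrier_mat n n"
    by (simp add: A_def skew_adjacency_mat_def len)
  have entry: "A $$ (i, j) = skew_entry D (ws ! i) (ws ! j)" if "i < n" "j < n" for i j
    using that by (simp add: A_def skew_adjacency_mat_def len skew_entry_def)
  \<comment> \<open>Positions correspond to vertices, so the entries of \<open>A * A\<close> can be
    reindexed as sums over \<open>pverts D\<close>.\<close>
  have bij: "bij_betw ((!) ws) {..<n} (pverts D)"
    by (rule bij_betw_nth) (use ws len in auto)
  have AA: "(A * A) $$ (i, j) =
      (\<Sum>w\<in>pverts D. skew_entry D (ws ! i) w * skew_entry D w (ws ! j))" if "i < n" "j < n" for i j
  proof -
    have "(A * A) $$ (i, j) = (\<Sum>l<n. skew_entry D (ws ! i) (ws ! l) * skew_entry D (ws ! l) (ws ! j))"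
      using A that by (auto simp: scalar_prod_def atLeast0LessThan entry)
    also have "\<dots> = (\<Sum>w\<in>pverts D. skew_entry D (ws ! i) w * skew_entry D w (ws ! j))"
      by (rule sum.reindex_bij_betw[OF bij])
    finally show ?thesis .
  qed
  have skew: "cnj (A $$ (i, j)) = - A $$ (j, i)" if "i < n" "j < n" for i j
    using that skew_entry_swap[OF D, of "ws ! i" "ws ! j"]
    by (simp add: entry) (simp add: skew_entry_def)
  \<comment> \<open>Regularity determines the diagonal of the square; the energy condition then
    governs the remaining entries.\<close>
  have diag: "(A * A) $$ (i, i) = - of_real (real d)" if "i < n" for i
    using that bij by (simp add: AA sum_skew_entry_diag[OF D] deg bij_betw_apply del: index_mult_mat(1))
  have "skew_energy D = real n * sqrt (real d) \<longleftrightarrow> A * A = (- of_real (real d)) \<cdot>\<^sub>m 1\<^sub>m n"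
    using skew_hermitian_square_of_energy[OF A _ skew diag] mat_energy_of_square[OF A]
    by (auto simp: skew_energy_def Let_def mat_energy_def A_def ws_def)
  also have "\<dots> \<longleftrightarrow> (\<forall>i<n. \<forall>j<n. (A * A) $$ (i, j) = (if i = j then - of_nat d else 0))"
    using A by (auto simp: mat_eq_iff simp del: index_mult_mat(1))
  also have "\<dots> \<longleftrightarrow> (\<forall>i<n. \<forall>j<n.
      (\<Sum>w\<in>pverts D. skew_entry D (ws ! i) w * skew_entry D w (ws ! j)) =
      (if ws ! i = ws ! j then - of_nat d else 0))"
    using ws(1) len by (simp add: AA nth_eq_iff_index_eq del: index_mult_mat(1))
  also have "\<dots> \<longleftrightarrow> ?orth"
    unfolding ws(2)[symmetric] by (simp add: all_set_conv_all_nth len)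
  finally show ?thesis by (simp add: n_def)
qed

lemma bipartition_underlyingD:
  assumes bip: "bipartition (underlying D) X Y" and arc: "(u, v) \<in> parcs D"
  shows "u \<in> X \<and> u \<notin> Y \<and> v \<in> Y \<and> v \<notin> X \<or> u \<in> Y \<and> u \<notin> X \<and> v \<in> X \<and> v \<notin> Y"
proof -
  have "(u, v) \<in> parcs (underlying D)"
    using arc by (simp add: in_parcs_underlying_iff)
  then show ?thesis
    using bip by (auto simp: bipartition_def)
qed

section \<open>Arcs of the oriented strong product\<close>

text \<open>In an oriented graph an edge that is not an arc one way is an arc the other way, so each
  \<open>_rev\<close> rule can be restated positively. The rules for edges moving in both
  coordinates are anchored at the end in \<open>X\<close>; the last disjunct is what
  \<open>both_rev\<close> yields for arcs starting in \<open>Y\<close>.\<close>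

lemma in_strong_arcs_iff:
  assumes D: "oriented_graph D" and E: "oriented_graph E" and bip: "bipartition (underlying D) X Y"
  shows "((u1, v1), (u2, v2)) \<in> strong_arcs X Y D E \<longleftrightarrow>
    u1 = u2 \<and> u1 \<in> X \<and> (v1, v2) \<in> parcs E \<or>
    u1 = u2 \<and> u1 \<in> Y \<and> (v2, v1) \<in> parcs E \<or>
    v1 = v2 \<and> v1 \<in> pverts E \<and> (u1, u2) \<in> parcs D \<or>
    u1 \<in> X \<and> ((u1, u2) \<in> parcs D \<and> (v1, v2) \<in> parcs E \<or> (u2, u1) \<in> parcs D \<and> (v2, v1) \<in> parcs E) \<or>
    u1 \<in> Y \<and> ((u1, u2) \<in> parcs D \<and> (v2, v1) \<in> parcs E \<or> (u2, u1) \<in> parcs D \<and> (v1, v2) \<in> parcs E)"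
    (is "_ \<longleftrightarrow> ?R")
proof -
  note facts = oriented_graph_parcs(4)[OF D, of u1 u2] oriented_graph_parcs(4)[OF E, of v1 v2]
    bipartition_underlyingD[OF bip, of u1 u2] bipartition_underlyingD[OF bip, of u2 u1]
    in_parcs_underlying_iff[of u1 u2 D] in_parcs_underlying_iff[of u2 u1 D]
    in_parcs_underlying_iff[of v1 v2 E] in_parcs_underlying_iff[of v2 v1 E]
  show ?thesis
  proof
    assume "((u1, v1), (u2, v2)) \<in> strong_arcs X Y D E"
    then show ?R
      by cases (use facts in auto)
  next
    assume ?R
    then show "((u1, v1), (u2, v2)) \<in> strong_arcs X Y D E"
    proof (elim disjE conjE)
      \<comment> \<open>The other end \<open>u2\<close> lies in \<open>X\<close>, so
        \<open>both_rev\<close> applies with the two ends exchanged.\<close>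
      assume "u1 \<in> Y" "(u1, u2) \<in> parcs D" "(v2, v1) \<in> parcs E"
      then show ?thesis
        using facts by (intro both_rev) auto
    next
      assume "u1 \<in> Y" "(u2, u1) \<in> parcs D" "(v1, v2) \<in> parcs E"
      then show ?thesis
        using facts by (intro both_rev) auto
    next
      assume "u1 = u2" "u1 \<in> X" "(v1, v2) \<in> parcs E"
      then show ?thesis
        using facts in_X by fastforce
    next
      assume "u1 = u2" "u1 \<in> Y" "(v2, v1) \<in> parcs E"
      then show ?thesis
        using facts in_Y by fastforce
    next
      assume "v1 = v2" "v1 \<in> pverts E" "(u1, u2) \<in> parcs D"
      then show ?thesis
        using facts same_v by fastforce
    next
      assume "u1 \<in> X" "(u1, u2) \<in> parcs D" "(v1, v2) \<in> parcs E"
      then show ?thesis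
        using facts by (intro both) auto
    next
      assume "u1 \<in> X" "(u2, u1) \<in> parcs D" "(v2, v1) \<in> parcs E"
      then show ?thesis
        using facts by (intro both) auto
    qed
  qed
qed

text \<open>An edge of each kind receives one of its two directions, and no rule leaves the edges of
  the strong product. The case split fixes which coordinates agree and how the arcs of the factors
  point.\<close>

lemma underlying_oriented_strong_product:
  assumes D: "oriented_graph D" and E: "oriented_graph E" and bip: "bipartition (underlying D) X Y"
  shows "underlying (oriented_strong_product X Y D E) =
    strong_product (underlying D) (underlying E)" (is "?P = ?S")
proof -
  have V: "pverts D = X \<union> Y"
    using bip by (simp add: bipartition_def)
  have "(p, q) \<in> parcs ?P \<longleftrightarrow> (p, q) \<in> parcs ?S" for p q
  proof -
    obtain u1 v1 u2 v2 where pq: "p = (u1, v1)" "q = (u2, v2)"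
      by (metis surj_pair)
    note facts = oriented_graph_parcs[OF D, of u1 u2] oriented_graph_parcs[OF D, of u2 u1]
      oriented_graph_parcs[OF E, of v1 v2] oriented_graph_parcs[OF E, of v2 v1]
      bipartition_underlyingD[OF bip, of u1 u2] bipartition_underlyingD[OF bip, of u2 u1]
    have S: "(p, q) \<in> parcs ?S \<longleftrightarrow>
        u1 \<in> pverts D \<and> v1 \<in> pverts E \<and> u2 \<in> pverts D \<and> v2 \<in> pverts E \<and> (u1 \<noteq> u2 \<or> v1 \<noteq> v2) \<and>
        (u1 = u2 \<or> (u1, u2) \<in> parcs D \<or> (u2, u1) \<in> parcs D) \<and>
        (v1 = v2 \<or> (v1, v2) \<in> parcs E \<or> (v2, v1) \<in> parcs E)"
      by (auto simp: pq strong_product_def in_parcs_underlying_iff)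
    show ?thesis
      unfolding S unfolding pq in_parcs_underlying_iff oriented_strong_product_def
        pair_pre_digraph.simps in_strong_arcs_iff[OF assms]
      using facts V by (cases "u1 = u2"; cases "v1 = v2"; cases "(u1, u2) \<in> parcs D"; cases "(v1, v2) \<in> parcs E")
        auto
  qed
  then have "parcs ?P = parcs ?S" by auto
  moreover have "pverts ?P = pverts ?S"
    by (simp add: oriented_strong_product_def strong_product_def)
  ultimately show ?thesis
    by (simp add: pair_pre_digraph.equality)
qed

text \<open>Endpoints and loop-freeness are inherited from the strong product. For an edge moving in
  both coordinates, exchanging the ends also exchanges \<open>X\<close> and \<open>Y\<close>, whose
  conditions are complementary, so only one direction occurs.\<close>

lemma oriented_graph_oriented_strong_product:
  assumes D: "oriented_graph D" and E: "oriented_graph E" and bip: "bipartition (underlying D) X Y"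
  shows "oriented_graph (oriented_strong_product X Y D E)" (is "oriented_graph ?P")
proof -
  have sub: "parcs ?P \<subseteq> parcs (strong_product (underlying D) (underlying E))"
    unfolding underlying_oriented_strong_product[OF assms, symmetric]
    by (auto simp: in_parcs_underlying_iff)
  have fin: "finite (pverts ?P)"
    using oriented_graph_finite_verts[OF D] oriented_graph_finite_verts[OF E]
    by (simp add: oriented_strong_product_def)
  have wf: "parcs ?P \<subseteq> pverts ?P \<times> pverts ?P"
    using sub by (auto simp: strong_product_def oriented_strong_product_def)
  have loop: "fst e \<noteq> snd e" if "e \<in> parcs ?P" for e
    using sub that by (auto simp: strong_product_def)
  have "pair_digraph ?P"
    using wf fin loop by unfold_locales (auto intro: finite_subset)
  moreover have "(q, p) \<notin> parcs ?P" if "(p, q) \<in> parcs ?P" for p q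
  proof -
    obtain u1 v1 u2 v2 where pq: "p = (u1, v1)" "q = (u2, v2)"
      by (metis surj_pair)
    note facts = oriented_graph_parcs(3,4)[OF D, of u1 u2] oriented_graph_parcs(3,4)[OF D, of u2 u1]
      oriented_graph_parcs(3,4)[OF E, of v1 v2] oriented_graph_parcs(3,4)[OF E, of v2 v1]
      bipartition_underlyingD[OF bip, of u1 u2] bipartition_underlyingD[OF bip, of u2 u1]
    have disj: "u \<in> X \<Longrightarrow> u \<notin> Y" for u
      using bip by (auto simp: bipartition_def)
    show ?thesis
      using that unfolding pq oriented_strong_product_def
        pair_pre_digraph.simps in_strong_arcs_iff[OF assms]
      using facts disj by (cases "u1 = u2"; cases "v1 = v2"; cases "(u1, u2) \<in> parcs D"; cases "(v1, v2) \<in> parcs E")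
        auto
  qed
  ultimately show ?thesis
    by (auto simp: oriented_graph_def)
qed

text \<open>The entrywise form of \<open>S = P (I + S\<^sub>H) \<otimes> S\<^sub>G + S\<^sub>H
  \<otimes> I\<close>. The three kinds of edges each account for one term: equal first coordinates
  for P times the entry of G, equal second coordinates for the entry of H, and edges moving in both
  for the signed product.\<close>

lemma skew_entry_oriented_strong_product:
  fixes X :: "'a set"
  defines "\<epsilon> \<equiv> \<lambda>u. if u \<in> X then 1 else - 1"
  assumes D: "oriented_graph D" and E: "oriented_graph E" and bip: "bipartition (underlying D) X Y"
    and V: "u1 \<in> pverts D" "u2 \<in> pverts D" "v1 \<in> pverts E" "v2 \<in> pverts E"
  shows "skew_entry (oriented_strong_product X Y D E) (u1, v1) (u2, v2) =
    \<epsilon> u1 * ((if u1 = u2 then 1 else 0) + skew_entry D u1 u2) * skew_entry E v1 v2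
    + skew_entry D u1 u2 * (if v1 = v2 then 1 else 0)"
proof -
  note part = bipartition_underlyingD[OF bip]
  have XY: "u \<in> Y \<longleftrightarrow> u \<notin> X" if "u \<in> pverts D" for u
    using bip that by (auto simp: bipartition_def)
  note arcs = in_strong_arcs_iff[OF D E bip]
  have P: "skew_entry (oriented_strong_product X Y D E) (u1, v1) (u2, v2) =
    (if ((u1, v1), (u2, v2)) \<in> strong_arcs X Y D E then 1
     else if ((u2, v2), (u1, v1)) \<in> strong_arcs X Y D E then - 1 else 0)"
    by (simp add: skew_entry_def oriented_strong_product_def)
  consider "u1 = u2" | "u1 \<noteq> u2" "v1 = v2" | "u1 \<noteq> u2" "v1 \<noteq> v2" by blast
  then show ?thesis
  proof cases
    case 1
    then show ?thesis
      using oriented_graph_parcs(3)[OF D, of u1 u1] oriented_graph_parcs(3,4)[OF E, of v1 v2]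
        oriented_graph_parcs(3)[OF E, of v2 v1] V XY[of u1]
      unfolding P arcs by (auto simp: skew_entry_def \<epsilon>_def)
  next
    case 2
    then show ?thesis
      using oriented_graph_parcs(4)[OF D, of u1 u2] oriented_graph_parcs(3)[OF E, of v1 v1] V
      unfolding P arcs by (auto simp: skew_entry_def)
  next
    case 3
    have \<epsilon>: "\<epsilon> u1 = (if u1 \<in> X then 1 else - 1)" by (simp add: \<epsilon>_def)
    consider "(u1, u2) \<in> parcs D" | "(u2, u1) \<in> parcs D"
      | "(u1, u2) \<notin> parcs D" "(u2, u1) \<notin> parcs D" by blast
    then show ?thesis
      unfolding P arcs skew_entry_def[of D] skew_entry_def[of E] \<epsilon>
      by cases (use 3 oriented_graph_parcs(4)[OF D, of u1 u2] oriented_graph_parcs(4)[OF D, of u2 u1]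
        oriented_graph_parcs(4)[OF E, of v1 v2] V XY[of u1] XY[of u2] part[of u1 u2] part[of u2 u1] in
        auto)
  qed
qed

section \<open>The square of the product matrix\<close>

text \<open>With products of matrix entries for \<open>f\<close> and \<open>g\<close>, this is the
  rule that Kronecker products multiply factor by factor.\<close>

lemma sum_Times_mult:
  fixes f :: "'a \<Rightarrow> 'c :: comm_semiring_0"
  shows "(\<Sum>p\<in>A \<times> B. f (fst p) * g (snd p)) = (\<Sum>a\<in>A. f a) * (\<Sum>b\<in>B. g b)"
  by (simp add: sum_product sum.cartesian_product case_prod_unfold)

lemma sum_skew_entry_oriented_strong_product:
  assumes D: "oriented_graph D" and E: "oriented_graph E" and bip: "bipartition (underlying D) X Y"
    and orthD: "\<And>u u'. u \<in> pverts D \<Longrightarrow> u' \<in> pverts D \<Longrightarrow>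
      (\<Sum>w\<in>pverts D. skew_entry D u w * skew_entry D w u') = (if u = u' then - of_nat k else 0)"
    and orthE: "\<And>v v'. v \<in> pverts E \<Longrightarrow> v' \<in> pverts E \<Longrightarrow>
      (\<Sum>w\<in>pverts E. skew_entry E v w * skew_entry E w v') = (if v = v' then - of_nat l else 0)"
    and p: "p \<in> pverts D \<times> pverts E" and q: "q \<in> pverts D \<times> pverts E"
  shows "(\<Sum>r\<in>pverts D \<times> pverts E. skew_entry (oriented_strong_product X Y D E) p r *
      skew_entry (oriented_strong_product X Y D E) r q) =
    (if p = q then - of_nat (k + l + k * l) else 0)"
proof -
  define \<epsilon> :: "'a \<Rightarrow> complex" where "\<epsilon> = (\<lambda>u. if u \<in> X then 1 else - 1)"
  define h where "h = skew_entry D"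
  define g where "g = skew_entry E"
  \<comment> \<open>As matrices, \<open>a\<close> is P (I + S_H), \<open>h\<close> is S_H,
    \<open>g\<close> is S_G and \<open>e\<close> is the identity on the vertices of
    \<open>E\<close>.\<close>
  define a where "a u w = \<epsilon> u * ((if u = w then 1 else 0) + h u w)" for u w
  define e :: "'b \<Rightarrow> 'b \<Rightarrow> complex" where "e v w = (if v = w then 1 else 0)" for v w
  obtain u1 v1 u2 v2 where pq: "p = (u1, v1)" "q = (u2, v2)"
    by (metis surj_pair)
  have V: "u1 \<in> pverts D" "u2 \<in> pverts D" "v1 \<in> pverts E" "v2 \<in> pverts E"
    using p q by (auto simp: pq)
  have fin: "finite (pverts D)" "finite (pverts E)"
    using D E by (auto intro: oriented_graph_finite_verts)
  have \<epsilon>2: "\<epsilon> u * (\<epsilon> u * x) = x" for u x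
    by (simp add: \<epsilon>_def)
  \<comment> \<open>Arcs of \<open>D\<close> cross the bipartition, so wherever \<open>h u w\<close>
    is nonzero the signs of \<open>u\<close> and \<open>w\<close> are opposite.\<close>
  have anti: "\<epsilon> u * h u w = - (h u w * \<epsilon> w)" for u w
    using bipartition_underlyingD[OF bip, of u w] bipartition_underlyingD[OF bip, of w u]
    by (auto simp: h_def skew_entry_def \<epsilon>_def)
  have entry: "skew_entry (oriented_strong_product X Y D E) (u, v) (u', v') =
      a u u' * g v v' + h u u' * e v v'"
    if "u \<in> pverts D" "u' \<in> pverts D" "v \<in> pverts E" "v' \<in> pverts E" for u v u' v'
    using skew_entry_oriented_strong_product[OF D E bip that]
    by (simp add: a_def g_def h_def e_def \<epsilon>_def)
  define \<delta> :: complex where "\<delta> = (if u1 = u2 then 1 else 0)"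
  have hh: "(\<Sum>w\<in>pverts D. h u1 w * h w u2) = - of_nat k * \<delta>"
    using orthD[OF V(1,2)] by (simp add: h_def \<delta>_def)
  have gg: "(\<Sum>w\<in>pverts E. g v1 w * g w v2) = - of_nat l * e v1 v2"
    using orthE[OF V(3,4)] by (simp add: g_def e_def)
  have eg: "(\<Sum>w\<in>pverts E. e v1 w * g w v2) = g v1 v2"
    and ge: "(\<Sum>w\<in>pverts E. g v1 w * e w v2) = g v1 v2"
    and ee: "(\<Sum>w\<in>pverts E. e v1 w * e w v2) = e v1 v2"
    using fin(2) V by (simp_all add: e_def if_distrib[of "\<lambda>x. x * _"] if_distrib[of "\<lambda>x. _ * x"]
        sum.delta sum.delta' cong: if_cong)
  have ah: "(\<Sum>w\<in>pverts D. a u1 w * h w u2) = \<epsilon> u1 * h u1 u2 - \<epsilon> u1 * of_nat k * \<delta>"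
  proof -
    have "(\<Sum>w\<in>pverts D. a u1 w * h w u2) =
        (\<Sum>w\<in>pverts D. (if w = u1 then \<epsilon> u1 * h u1 u2 else 0) + \<epsilon> u1 * (h u1 w * h w u2))"
      by (intro sum.cong) (auto simp: a_def algebra_simps)
    also have "\<dots> = \<epsilon> u1 * h u1 u2 + \<epsilon> u1 * (\<Sum>w\<in>pverts D. h u1 w * h w u2)"
      using fin(1) V by (simp add: sum.distrib sum_distrib_left)
    finally show ?thesis by (simp add: hh)
  qed
  have ha: "(\<Sum>w\<in>pverts D. h u1 w * a w u2) = \<epsilon> u2 * h u1 u2 + \<epsilon> u2 * of_nat k * \<delta>"
  proof -
    \<comment> \<open>Carrying the sign of \<open>w\<close> past \<open>h w u2\<close> by
      \<open>anti\<close> turns it into the sign of \<open>u2\<close> and produces the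
      minus.\<close>
    have "h u1 w * a w u2 = (if w = u2 then \<epsilon> u2 * h u1 u2 else 0) - \<epsilon> u2 * (h u1 w * h w u2)" for w
    proof -
      have "h u1 w * a w u2 = (if w = u2 then \<epsilon> u2 * h u1 u2 else 0) + h u1 w * (\<epsilon> w * h w u2)"
        by (auto simp: a_def algebra_simps)
      then show ?thesis by (simp add: anti)
    qed
    then have "(\<Sum>w\<in>pverts D. h u1 w * a w u2) =
        \<epsilon> u2 * h u1 u2 - \<epsilon> u2 * (\<Sum>w\<in>pverts D. h u1 w * h w u2)"
      using fin(1) V by (simp add: sum_subtractf sum_distrib_left)
    then show ?thesis by (simp add: hh)
  qed
  \<comment> \<open>As P anticommutes with S_H and has square I, the square of P (I + S_H) is (I -
    S_H)(I + S_H) = I - S_H^2, and S_H^2 = - k I. The computation expands the left factor and reuses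
    \<open>ha\<close>.\<close>
  have aa: "(\<Sum>w\<in>pverts D. a u1 w * a w u2) = (1 + of_nat k) * \<delta>"
  proof -
    have "(\<Sum>w\<in>pverts D. a u1 w * a w u2) =
        (\<Sum>w\<in>pverts D. (if w = u1 then \<epsilon> u1 * a u1 u2 else 0) + \<epsilon> u1 * (h u1 w * a w u2))"
      by (intro sum.cong) (auto simp: a_def algebra_simps)
    also have "\<dots> = \<epsilon> u1 * a u1 u2 + \<epsilon> u1 * (\<Sum>w\<in>pverts D. h u1 w * a w u2)"
      using fin(1) V by (simp add: sum.distrib sum_distrib_left)
    also have "\<dots> = \<delta> + h u1 u2 + \<epsilon> u2 * (\<epsilon> u1 * h u1 u2) + \<epsilon> u1 * (\<epsilon> u2 * (of_nat k * \<delta>))"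
      unfolding ha unfolding a_def \<epsilon>2 \<delta>_def[symmetric] by (simp add: algebra_simps)
    also have "\<epsilon> u2 * (\<epsilon> u1 * h u1 u2) = - h u1 u2"
      by (simp add: anti mult.commute[of _ "\<epsilon> u2"] \<epsilon>2)
    also have "\<epsilon> u1 * (\<epsilon> u2 * (of_nat k * \<delta>)) = of_nat k * \<delta>"
      by (cases "u1 = u2") (simp_all only: \<delta>_def \<epsilon>2 if_True if_False mult_zero_right)
    finally show ?thesis by (simp add: algebra_simps)
  qed
  \<comment> \<open>Anticommutation cancels the terms linear in \<open>h\<close>; those with
    \<delta> matter only for \<open>u1 = u2\<close>, where the signs coincide.\<close>
  have mixed: "(\<Sum>w\<in>pverts D. a u1 w * h w u2) + (\<Sum>w\<in>pverts D. h u1 w * a w u2) = 0"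
    unfolding ah ha anti by (auto simp: \<delta>_def)
  let ?S = "skew_entry (oriented_strong_product X Y D E)"
  have "(\<Sum>r\<in>pverts D \<times> pverts E. ?S p r * ?S r q) =
      (\<Sum>r\<in>pverts D \<times> pverts E.
        (a u1 (fst r) * a (fst r) u2) * (g v1 (snd r) * g (snd r) v2) +
        (a u1 (fst r) * h (fst r) u2) * (g v1 (snd r) * e (snd r) v2) +
        (h u1 (fst r) * a (fst r) u2) * (e v1 (snd r) * g (snd r) v2) +
        (h u1 (fst r) * h (fst r) u2) * (e v1 (snd r) * e (snd r) v2))"
    by (intro sum.cong) (auto simp: pq entry V algebra_simps)
  also have "\<dots> =
      (\<Sum>w\<in>pverts D. a u1 w * a w u2) * (\<Sum>w\<in>pverts E. g v1 w * g w v2) +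
      (\<Sum>w\<in>pverts D. a u1 w * h w u2) * (\<Sum>w\<in>pverts E. g v1 w * e w v2) +
      (\<Sum>w\<in>pverts D. h u1 w * a w u2) * (\<Sum>w\<in>pverts E. e v1 w * g w v2) +
      (\<Sum>w\<in>pverts D. h u1 w * h w u2) * (\<Sum>w\<in>pverts E. e v1 w * e w v2)"
    unfolding sum.distrib
    using sum_Times_mult[of "\<lambda>w. a u1 w * a w u2" "\<lambda>w. g v1 w * g w v2" "pverts D" "pverts E"]
      sum_Times_mult[of "\<lambda>w. a u1 w * h w u2" "\<lambda>w. g v1 w * e w v2" "pverts D" "pverts E"]
      sum_Times_mult[of "\<lambda>w. h u1 w * a w u2" "\<lambda>w. e v1 w * g w v2" "pverts D" "pverts E"]
      sum_Times_mult[of "\<lambda>w. h u1 w * h w u2" "\<lambda>w. e v1 w * e w v2" "pverts D" "pverts E"]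
    by simp
  \<comment> \<open>Both mixed terms carry the same factor \<open>g v1 v2\<close>, so their
    coefficients can be added and vanish. What remains on the diagonal is -(1 + k) l - k.\<close>
  also have "\<dots> = (1 + of_nat k) * \<delta> * (- of_nat l * e v1 v2) +
      ((\<Sum>w\<in>pverts D. a u1 w * h w u2) + (\<Sum>w\<in>pverts D. h u1 w * a w u2)) * g v1 v2 +
      - of_nat k * \<delta> * e v1 v2"
    unfolding aa gg ge eg hh ee by (simp add: algebra_simps)
  also have "\<dots> = (if p = q then - of_nat (k + l + k * l) else 0)"
    unfolding mixed by (simp add: pq \<delta>_def e_def algebra_simps)
  finally show ?thesis .
qed

section \<open>Degrees and conclusion\<close>

text \<open>The neighbours of \<open>(u, v)\<close> form the product of the two closed
  neighbourhoods without \<open>(u, v)\<close> itself, which has (k + 1)(l + 1) - 1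
  elements.\<close>

lemma out_degree_strong_product:
  assumes H: "pair_graph H" and G: "pair_graph G" and u: "u \<in> pverts H" and v: "v \<in> pverts G"
    and k: "out_degree (with_proj H) u = k" and l: "out_degree (with_proj G) v = l"
  shows "out_degree (with_proj (strong_product H G)) (u, v) = k + l + k * l"
proof -
  interpret H: pair_graph H by fact
  interpret G: pair_graph G by fact
  let ?M = "{w. (u, w) \<in> parcs H}" and ?N = "{w. (v, w) \<in> parcs G}"
  have fin: "finite ?M" "finite ?N"
    by (auto intro: finite_subset[OF _ H.pair_finite_verts] finite_subset[OF _ G.pair_finite_verts]
        dest: H.wellformed' G.wellformed')
  have nbrs: "{w. ((u, v), w) \<in> parcs (strong_product H G)} = insert u ?M \<times> insert v ?N - {(u, v)}"
    using u v by (auto simp: strong_product_def dest: H.wellformed' G.wellformed')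
  have "u \<notin> ?M" "v \<notin> ?N"
    using H.pair_no_loops[of "(u, u)"] G.pair_no_loops[of "(v, v)"] by auto
  then have "card (insert u ?M \<times> insert v ?N) = Suc k * Suc l"
    unfolding card_cartesian_product using fin k l by (simp add: out_degree_with_proj)
  then have "card (insert u ?M \<times> insert v ?N - {(u, v)}) = Suc k * Suc l - 1"
    by (subst card_Diff_singleton) auto
  then show ?thesis
    unfolding out_degree_with_proj nbrs by simp
qed

lemma pair_graph_underlying:
  assumes "oriented_graph D"
  shows "pair_graph (underlying D)"
proof -
  interpret pair_digraph D using assms by (simp add: oriented_graph_def)
  interpret U: pair_digraph "underlying D" by (rule digraph_mk_symmetric)
  show ?thesis
    using symmetric_mk_symmetric by unfold_locales
qed

theorem theorem2p7:
  fixes H H\<tau> :: "'a pair_pre_digraph" and G\<sigma> :: "'b pair_pre_digraph"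
    and X Y :: "'a set" and k l m n :: nat
  assumes "regular_graph k H" and "card (pverts H) = m" and "bipartition H X Y"
    and "orientation_of H\<tau> H" and "skew_energy H\<tau> = real m * sqrt (real k)"
    and "oriented_graph G\<sigma>" and "regular_graph l (underlying G\<sigma>)" and "card (pverts G\<sigma>) = n"
    and "skew_energy G\<sigma> = real n * sqrt (real l)"
  shows "orientation_of (oriented_strong_product X Y H\<tau> G\<sigma>) (strong_product H (underlying G\<sigma>)) \<and>
    regular_graph (k + l + k * l) (underlying (oriented_strong_product X Y H\<tau> G\<sigma>)) \<and>
    skew_energy (oriented_strong_product X Y H\<tau> G\<sigma>) =
      max_skew_energy (oriented_strong_product X Y H\<tau> G\<sigma>) \<and>
    skew_energy (oriented_strong_product X Y H\<tau> G\<sigma>) =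
      real m * real n * sqrt (real (k + l + k * l))"
proof -
  let ?P = "oriented_strong_product X Y H\<tau> G\<sigma>" and ?d = "k + l + k * l"
  have D: "oriented_graph H\<tau>" and H: "underlying H\<tau> = H"
    using assms(4) by (auto simp: orientation_of_def)
  note E = assms(6)
  have bip: "bipartition (underlying H\<tau>) X Y"
    using assms(3) by (simp add: H)
  have VH: "pverts H\<tau> = pverts H"
    using pverts_mk_symmetric[of "with_proj H\<tau>"] H by simp
  have U: "underlying ?P = strong_product H (underlying G\<sigma>)"
    using underlying_oriented_strong_product[OF D E bip] by (simp add: H)
  have P: "oriented_graph ?P"
    by (rule oriented_graph_oriented_strong_product[OF D E bip])
  have V: "pverts ?P = pverts H\<tau> \<times> pverts G\<sigma>"
    by (simp add: oriented_strong_product_def)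
  have card: "card (pverts ?P) = m * n"
    using assms(2,8) by (simp add: V VH card_cartesian_product)
  have degH: "out_degree (with_proj (underlying H\<tau>)) u = k" if "u \<in> pverts H\<tau>" for u
    using assms(1) that by (simp add: regular_graph_def H VH)
  have degG: "out_degree (with_proj (underlying G\<sigma>)) v = l" if "v \<in> pverts G\<sigma>" for v
    using assms(7) that by (simp add: regular_graph_def)
  have degP: "out_degree (with_proj (underlying ?P)) w = ?d" if "w \<in> pverts ?P" for w
  proof -
    obtain u v where w: "w = (u, v)" by (cases w)
    show ?thesis
      using that assms(1,7) degH degG unfolding U w
      by (intro out_degree_strong_product) (auto simp: V regular_graph_def H VH)
  qed
  have "skew_energy ?P = real (card (pverts ?P)) * sqrt (real ?d)"
  proof (subst skew_energy_eq_max_iff[OF P degP], assumption, intro ballI)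
    fix p q assume pq: "p \<in> pverts ?P" "q \<in> pverts ?P"
    have orthH: "(\<Sum>w\<in>pverts H\<tau>. skew_entry H\<tau> u w * skew_entry H\<tau> w u') =
        (if u = u' then - of_nat k else 0)" if "u \<in> pverts H\<tau>" "u' \<in> pverts H\<tau>" for u u'
      using skew_energy_eq_max_iff[OF D degH] assms(2,5) that by (simp add: VH)
    have orthG: "(\<Sum>w\<in>pverts G\<sigma>. skew_entry G\<sigma> v w * skew_entry G\<sigma> w v') =
        (if v = v' then - of_nat l else 0)" if "v \<in> pverts G\<sigma>" "v' \<in> pverts G\<sigma>" for v v'
      using skew_energy_eq_max_iff[OF E degG] assms(8,9) that by simp
    show "(\<Sum>w\<in>pverts ?P. skew_entry ?P p w * skew_entry ?P w q) =
        (if p = q then - of_nat ?d else 0)"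
      using sum_skew_entry_oriented_strong_product[OF D E bip orthH orthG] pq by (simp only: V)
  qed
  then have energy: "skew_energy ?P = real m * real n * sqrt (real ?d)"
    by (simp add: card)
  \<comment> \<open>\<open>Max\<close> of the empty set has no useful value, so an empty vertex set
    is treated apart: there the factor \<open>card (pverts ?P)\<close> makes both sides 0.\<close>
  have "max_degree (underlying ?P) = ?d" if "pverts ?P \<noteq> {}"
  proof -
    have "out_degree (with_proj (underlying ?P)) ` pverts (underlying ?P) = {?d}"
      using that degP by auto
    then show ?thesis by (simp add: max_degree_def)
  qed
  then have "max_skew_energy ?P = real m * real n * sqrt (real ?d)"
    using card by (cases "pverts ?P = {}") (auto simp: max_skew_energy_def)
  moreover have "regular_graph ?d (underlying ?P)"
    using pair_graph_underlying[OF P] degP by (simp add: regular_graph_def)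
  moreover have "orientation_of ?P (strong_product H (underlying G\<sigma>))"
    using P U by (simp add: orientation_of_def)
  ultimately show ?thesis
    using energy by simp
qed

end
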